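(* Let $A_t\in\mathcal{S}$ be a smooth curve satisfying the discrete Euler--Lagrange equations, i.e. for some $p=p(t)\in\mathbb{R}^N$, $$\left(\dot A_t^\flat+\mathbf{L}_{A_t}A_t^\flat+\mathbf{d}p\right)_{ij}=0\quad\text{for all } i \text{ and all } j\in N(i),$$ and let $\Gamma_0$ be an arbitrary discrete curve (an element of $\mathcal{S}$). Let $\Gamma_t\in\mathcal{S}$ be the curve $\Gamma_0$ advected by $A_t$. Then the circulation of $A_t$ along $\Gamma_t$ stays constant: $$C_{\Gamma_t}A_t=C_{\Gamma_0}A_0 .$$
   Context: Mesh. $\mathbb{M}$ is a mesh (simplicial or Cartesian, Delaunay with well-shaped elements) with cells $C_1,\dots,C_N$; $\Omega$ is the diagonal matrix with $\Omega_{ii}=\Omega_i=|C_i|$; $N(i)$ is the set of indices of cells sharing a face with $C_i$; for $j\in N(i)$, $S_{ij}=C_i\cap C_j$ is the common face, of area $|S_{ij}|$, and $e_{ij}$ is the dual edge (joining the circumcenters of $C_i$ and $C_j$), of length $|e_{ij}|$. $\mathcal{S}$ is the set of real $N\times N$ matrices $A$ with $A^T\Omega+\Omega A=0$, $\sum_jA_{ij}=0$ for all $i$, and $A_{ij}\ne0\Rightarrow j\in N(i)$. Discrete forms. $0$-forms are vectors in $\mathbb{R}^N$, $1$-forms are antisymmetric matrices $F$, $2$-forms are completely antisymmetric $3$-tensors $G$. $(\mathbf{d}f)_{ij}=f_j-f_i$, $(\mathbf{d}F)_{ijk}=F_{ij}+F_{jk}+F_{ki}$; $(\mathbf{i}_AF)_i=(AF^T)_{ii}$,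 $(\mathbf{i}_AG)_{ij}=\sum_k(G_{ikj}A_{ik}-G_{jki}A_{jk})$; $\mathbf{L}_AF=\mathbf{i}_A\mathbf{d}F+\mathbf{d}\mathbf{i}_AF$; $\langle\!\langle F,X\rangle\!\rangle=\mathrm{Tr}(\Omega XF^T)$. $[X,Y]=XY-YX$. Flat operator. $A\mapsto A^\flat$ is the linear map from $\mathcal{S}$ to antisymmetric $N\times N$ matrices with, for adjacent cells, $A^\flat_{ij}=\frac{2\Omega_i|e_{ij}|}{|S_{ij}|}A_{ij}$ ($j\in N(i)$). On a three-dimensional simplicial mesh, for non-adjacent $C_j,C_k$ with a common neighbour $C_i$, $A^\flat_{jk}$ is defined by $A^\flat_{ij}+A^\flat_{jk}+A^\flat_{ki}=K_{ijk}\,\omega_{\mathrm{DEC}}(e)$, where $e$ is the primal edge common to $C_i,C_j,C_k$; $K_{ijk}=\frac83 s_{ijk}\frac{|S_e\cap C_i|}{|S_e|}$ with $S_e$ the Voronoi face dual to $e$ and $s_{ijk}=1$ if the triplet $C_i,C_j,C_k$ is positively oriented around $e$ (turns clockwise when viewed along the oriented edge), $-1$ otherwise; and $\omega_{\mathrm{DEC}}(e)=\sum 2\Omega_i\frac{|e_{ij}|}{|S_{ij}|}A_{ij}s_{ij}$, summed over the faces $S_{ij}$ containing $e$, each counted once (the summand is symmetric in $i,j$), with $s_{ij}=1$ if $C_i,C_j$ are positively oriented around $e$ and $-1$ otherwise. All other entries vanish. On a two-dimensional Cartesian grid of size $h$, adjacent values are $2h^2A_{ij}$ and $A^\flat_{ij}=h^2\sum_{k\in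 N(i)\cap N(j)}(A_{ik}+A_{kj})$ for $i\notin N(j)$. Curves, circulation, advection. Discrete (closed) curves are represented by sparse null-row $\Omega$-antisymmetric matrices and are not distinguished from discrete velocities, i.e. they are elements of $\mathcal{S}$. The circulation of $A$ along $\Gamma$ is $C_\Gamma A=\langle\!\langle A^\flat,\Gamma\rangle\!\rangle$. A differentiable family $\Gamma_t\in\mathcal{S}$ is advected by $A_t$ if for every $t$, $$\langle\!\langle X^\flat,\dot\Gamma_t+[A_t,\Gamma_t]\rangle\!\rangle=0\quad\text{for all }X\in\mathcal{S}.$$ *)

theory Defs
  imports "HOL-Analysis.Analysis"
begin

section \<open>Meshes\<close>

text \<open>
  A mesh is an indexed family \<open>C :: 'n \<Rightarrow> (real^'d) set\<close> of its full-dimensional cells; the number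
  of cells is \<open>CARD('n)\<close> and the space dimension is \<open>CARD('d)\<close>.
\<close>

definition circumcenter :: "'a::euclidean_space set \<Rightarrow> 'a" where
  "circumcenter S = (THE c. \<exists>r. \<forall>v. v extreme_point_of S \<longrightarrow> dist c v = r)"

definition barycenter :: "'a::euclidean_space set \<Rightarrow> 'a" where
  "barycenter S = (\<Sum>v | v extreme_point_of S. v) /\<^sub>R real (card {v. v extreme_point_of S})"

definition vertices :: "('n \<Rightarrow> 'a::euclidean_space set) \<Rightarrow> 'a set" where
  "vertices C = {v. \<exists>i. v extreme_point_of C i}"

definition simplicial_mesh :: "('n::finite \<Rightarrow> (real^'d) set) \<Rightarrow> bool" where
  "simplicial_mesh C \<longleftrightarrow> inj C \<and> (\<forall>i. int CARD('d) simplex C i) \<and> triangulation (range C)"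

definition cartesian_grid :: "real \<Rightarrow> ('n::finite \<Rightarrow> (real^'d) set) \<Rightarrow> bool" where
  "cartesian_grid h C \<longleftrightarrow> h > 0 \<and> inj C \<and>
     (\<exists>p. \<forall>i. \<exists>z :: int^'d.
        C i = cbox (\<chi> k. p $ k + h * of_int (z $ k)) (\<chi> k. p $ k + h * (of_int (z $ k) + 1)))"

text \<open>No mesh vertex lies strictly inside the circumsphere of a cell.\<close>

definition delaunay :: "('n \<Rightarrow> 'a::euclidean_space set) \<Rightarrow> bool" where
  "delaunay C \<longleftrightarrow> (\<forall>i v w. v extreme_point_of C i \<longrightarrow> w \<in> vertices C \<longrightarrow>
     dist (circumcenter (C i)) v \<le> dist (circumcenter (C i)) w)"

definition mesh :: "('n::finite \<Rightarrow> (real^'d) set) \<Rightarrow> bool" where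
  "mesh C \<longleftrightarrow> (simplicial_mesh C \<or> (\<exists>h. cartesian_grid h C)) \<and> delaunay C"

definition neighbours :: "('n \<Rightarrow> 'a::euclidean_space set) \<Rightarrow> 'n \<Rightarrow> 'n set" where
  "neighbours C i = {j. (C i \<inter> C j) facet_of C i \<and> (C i \<inter> C j) facet_of C j}"

definition cell_volume :: "('n \<Rightarrow> 'a::euclidean_space set) \<Rightarrow> 'n \<Rightarrow> real" where
  "cell_volume C i = measure lebesgue (C i)"

definition Omega :: "('n::finite \<Rightarrow> 'a::euclidean_space set) \<Rightarrow> real^'n^'n" where
  "Omega C = (\<chi> i j. if i = j then cell_volume C i else 0)"

text \<open>
  The codimension-one volume of a subset \<open>S\<close> of a hyperplane, as the Lebesgue measure of the right
  prism of height one over \<open>S\<close>. (If \<open>S\<close> has smaller dimension, the unit normal is not determined,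
  but the prism is a null set for each choice.)
\<close>

definition area :: "'a::euclidean_space set \<Rightarrow> real" where
  "area S = (let u = (SOME u. norm u = 1 \<and> (\<forall>x\<in>S. \<forall>y\<in>S. u \<bullet> (x - y) = 0))
             in measure lebesgue {x + t *\<^sub>R u | x t. x \<in> S \<and> 0 \<le> t \<and> t \<le> 1})"

definition face_area :: "('n \<Rightarrow> 'a::euclidean_space set) \<Rightarrow> 'n \<Rightarrow> 'n \<Rightarrow> real" where
  "face_area C i j = area (C i \<inter> C j)"

definition dual_length :: "('n \<Rightarrow> 'a::euclidean_space set) \<Rightarrow> 'n \<Rightarrow> 'n \<Rightarrow> real" where
  "dual_length C i j = dist (circumcenter (C i)) (circumcenter (C j))"

section \<open>Discrete velocities and forms\<close>

definition velocities :: "('n::finite \<Rightarrow> 'a::euclidean_space set) \<Rightarrow> (real^'n^'n) set" where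
  "velocities C = {A. transpose A ** Omega C + Omega C ** A = 0 \<and>
     (\<forall>i. (\<Sum>j\<in>UNIV. A $ i $ j) = 0) \<and> (\<forall>i j. A $ i $ j \<noteq> 0 \<longrightarrow> j \<in> neighbours C i)}"

definition d0 :: "real^'n \<Rightarrow> real^'n^'n" where
  "d0 f = (\<chi> i j. f $ j - f $ i)"

definition d1 :: "real^'n^'n \<Rightarrow> real^'n^'n^'n" where
  "d1 F = (\<chi> i j k. F $ i $ j + F $ j $ k + F $ k $ i)"

definition contract1 :: "real^'n^'n \<Rightarrow> real^'n^'n \<Rightarrow> real^'n" where
  "contract1 A F = (\<chi> i. (A ** transpose F) $ i $ i)"

definition contract2 :: "real^'n^'n \<Rightarrow> real^'n^'n^'n \<Rightarrow> real^'n^'n" where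
  "contract2 A G = (\<chi> i j. \<Sum>k\<in>UNIV. G $ i $ k $ j * A $ i $ k - G $ j $ k $ i * A $ j $ k)"

definition lie1 :: "real^'n^'n \<Rightarrow> real^'n^'n \<Rightarrow> real^'n^'n" where
  "lie1 A F = contract2 A (d1 F) + d0 (contract1 A F)"

definition pairing :: "('n::finite \<Rightarrow> 'a::euclidean_space set) \<Rightarrow> real^'n^'n \<Rightarrow> real^'n^'n \<Rightarrow> real" where
  "pairing C F X = trace (Omega C ** X ** transpose F)"

definition commutator :: "real^'n^'n \<Rightarrow> real^'n^'n \<Rightarrow> real^'n^'n" where
  "commutator X Y = X ** Y - Y ** X"

section \<open>The flat operator\<close>

definition adjacent_flat :: "('n::finite \<Rightarrow> 'a::euclidean_space set) \<Rightarrow> real^'n^'n \<Rightarrow> 'n \<Rightarrow> 'n \<Rightarrow> real" where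
  "adjacent_flat C A i j = 2 * cell_volume C i * dual_length C i j / face_area C i j * A $ i $ j"

text \<open>
  A bijection \<open>\<sigma> :: 3 \<Rightarrow> 'd\<close> identifies \<open>real^'d\<close> with \<open>real^3\<close> and thereby orients it.
  For \<open>orient3 \<sigma> u v w > 0\<close> the rotation from \<open>v\<close> to \<open>w\<close> about \<open>u\<close> is clockwise when viewed along \<open>u\<close>.
\<close>

definition orient3 :: "(3 \<Rightarrow> 'd) \<Rightarrow> real^'d \<Rightarrow> real^'d \<Rightarrow> real^'d \<Rightarrow> real" where
  "orient3 \<sigma> u v w = (\<chi> c. u $ \<sigma> c) \<bullet> cross3 (\<chi> c. v $ \<sigma> c) (\<chi> c. w $ \<sigma> c)"

text \<open>
  The sign \<open>s\<^sub>i\<^sub>j\<close> around the edge from \<open>a\<close> to \<open>b\<close>, for adjacent cells \<open>i\<close>, \<open>j\<close> containing it: whether the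
  step from \<open>C i\<close> to \<open>C j\<close> crosses the common face, hence the plane through it, clockwise. The two
  barycenters lie strictly on opposite sides of that plane, so the sign is never zero; comparing the
  directions of the cell barycenters as seen from the edge would fail for angles beyond \<open>\<pi>\<close>.
\<close>

definition step_sign ::
    "(3 \<Rightarrow> 'd) \<Rightarrow> ('n \<Rightarrow> (real^'d) set) \<Rightarrow> real^'d \<Rightarrow> real^'d \<Rightarrow> 'n \<Rightarrow> 'n \<Rightarrow> real" where
  "step_sign \<sigma> C a b i j =
     sgn (orient3 \<sigma> (b - a) (barycenter (C i \<inter> C j) - a) (barycenter (C j) - barycenter (C i)))"

text \<open>
  The sign \<open>s\<^sub>i\<^sub>j\<^sub>k\<close>, for a common neighbour \<open>i\<close> of \<open>j\<close> and \<open>k\<close>: the cyclic order \<open>i, j, k\<close> is clockwise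
  around the edge iff within \<open>C i\<close> the dihedral angle (which is less than \<open>\<pi>\<close>) is swept clockwise from
  the face shared with \<open>C k\<close> to the face shared with \<open>C j\<close>.
\<close>

definition triple_sign ::
    "(3 \<Rightarrow> 'd) \<Rightarrow> ('n \<Rightarrow> (real^'d) set) \<Rightarrow> real^'d \<Rightarrow> real^'d \<Rightarrow> 'n \<Rightarrow> 'n \<Rightarrow> 'n \<Rightarrow> real" where
  "triple_sign \<sigma> C a b i j k =
     sgn (orient3 \<sigma> (b - a) (barycenter (C i \<inter> C k) - a) (barycenter (C i \<inter> C j) - a))"

text \<open>
  The part inside the mesh domain of the Voronoi face dual to the edge from \<open>a\<close> to \<open>b\<close>. (For a
  boundary edge the untruncated Voronoi face can be unbounded.)
\<close>

definition voronoi_face :: "('n \<Rightarrow> 'a::euclidean_space set) \<Rightarrow> 'a \<Rightarrow> 'a \<Rightarrow> 'a set" where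
  "voronoi_face C a b =
     {x \<in> (\<Union>i. C i). dist x a = dist x b \<and> (\<forall>v\<in>vertices C. dist x a \<le> dist x v)}"

definition K_coeff ::
    "(3 \<Rightarrow> 'd) \<Rightarrow> ('n \<Rightarrow> (real^'d) set) \<Rightarrow> real^'d \<Rightarrow> real^'d \<Rightarrow> 'n \<Rightarrow> 'n \<Rightarrow> 'n \<Rightarrow> real" where
  "K_coeff \<sigma> C a b i j k =
     8 / 3 * triple_sign \<sigma> C a b i j k * (area (voronoi_face C a b \<inter> C i) / area (voronoi_face C a b))"

text \<open>
  The factor \<open>1/2\<close> accounts for each face being enumerated as \<open>(i, j)\<close> and as \<open>(j, i)\<close>; the summand is
  symmetric for \<open>A \<in> velocities C\<close>.
\<close>

definition omega_DEC ::
    "(3 \<Rightarrow> 'd) \<Rightarrow> ('n::finite \<Rightarrow> (real^'d) set) \<Rightarrow> real^'n^'n \<Rightarrow> real^'d \<Rightarrow> real^'d \<Rightarrow> real" where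
  "omega_DEC \<sigma> C A a b =
     1 / 2 * (\<Sum>(i, j) | j \<in> neighbours C i \<and> closed_segment a b \<subseteq> C i \<inter> C j.
       adjacent_flat C A i j * step_sign \<sigma> C a b i j)"

text \<open>
  Reversing the edge or the orientation \<open>\<sigma>\<close> of space changes the sign of both \<open>K_coeff\<close> and
  \<open>omega_DEC\<close>, so the product does not depend on these choices. If exactly four cells surround an
  edge, two opposite ones have two common neighbours, and the prescriptions obtained from them can
  differ; the predicate therefore only asks that one common neighbour is used for each pair, and
  every selection rule is admitted.
\<close>

definition flat_simplicial3 ::
    "('n::finite \<Rightarrow> (real^'d) set) \<Rightarrow> (real^'n^'n \<Rightarrow> real^'n^'n) \<Rightarrow> bool" where
  "flat_simplicial3 C flat \<longleftrightarrow>
     (\<forall>j k. j \<noteq> k \<and> k \<notin> neighbours C j \<longrightarrow>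
       (if neighbours C j \<inter> neighbours C k = {}
        then \<forall>A\<in>velocities C. flat A $ j $ k = 0
        else \<exists>i \<in> neighbours C j \<inter> neighbours C k.
          \<forall>(\<sigma> :: 3 \<Rightarrow> 'd) a b. bij \<sigma> \<and> closed_segment a b = C i \<inter> C j \<inter> C k \<longrightarrow>
            (\<forall>A\<in>velocities C. flat A $ i $ j + flat A $ j $ k + flat A $ k $ i
               = K_coeff \<sigma> C a b i j k * omega_DEC \<sigma> C A a b)))"

definition flat_cartesian2 ::
    "real \<Rightarrow> ('n::finite \<Rightarrow> (real^'d) set) \<Rightarrow> (real^'n^'n \<Rightarrow> real^'n^'n) \<Rightarrow> bool" where
  "flat_cartesian2 h C flat \<longleftrightarrow>
     (\<forall>A\<in>velocities C. \<forall>i j. i \<notin> neighbours C j \<longrightarrow>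
        flat A $ i $ j = h\<^sup>2 * (\<Sum>k \<in> neighbours C i \<inter> neighbours C j. A $ i $ k + A $ k $ j))"

text \<open>
  On a planar grid of size \<open>h\<close> the formula for adjacent cells specializes to \<open>2 * h\<^sup>2 * A $ i $ j\<close>.
  On meshes that are neither tetrahedral nor planar grids, the entries for non-adjacent
  cells are left unspecified apart from linearity and antisymmetry.
\<close>

definition flat_operator ::
    "('n::finite \<Rightarrow> (real^'d) set) \<Rightarrow> (real^'n^'n \<Rightarrow> real^'n^'n) \<Rightarrow> bool" where
  "flat_operator C flat \<longleftrightarrow>
     (\<forall>A\<in>velocities C. \<forall>B\<in>velocities C. flat (A + B) = flat A + flat B) \<and>
     (\<forall>A\<in>velocities C. \<forall>c. flat (c *\<^sub>R A) = c *\<^sub>R flat A) \<and>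
     (\<forall>A\<in>velocities C. transpose (flat A) = - flat A) \<and>
     (\<forall>A\<in>velocities C. \<forall>i. \<forall>j\<in>neighbours C i. flat A $ i $ j = adjacent_flat C A i j) \<and>
     (CARD('d) = 3 \<and> simplicial_mesh C \<longrightarrow> flat_simplicial3 C flat) \<and>
     (\<forall>h. CARD('d) = 2 \<and> cartesian_grid h C \<longrightarrow> flat_cartesian2 h C flat)"

section \<open>Curves, circulation, advection\<close>

definition smooth_curve :: "real set \<Rightarrow> (real \<Rightarrow> 'a::real_normed_vector) \<Rightarrow> bool" where
  "smooth_curve T f \<longleftrightarrow> (\<exists>D :: nat \<Rightarrow> real \<Rightarrow> 'a. D 0 = f \<and>
     (\<forall>k. \<forall>t\<in>T. (D k has_vector_derivative D (Suc k) t) (at t within T)))"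

definition circulation ::
    "('n::finite \<Rightarrow> (real^'d) set) \<Rightarrow> (real^'n^'n \<Rightarrow> real^'n^'n) \<Rightarrow> real^'n^'n \<Rightarrow> real^'n^'n \<Rightarrow> real" where
  "circulation C flat \<Gamma> A = pairing C (flat A) \<Gamma>"

definition advected ::
    "('n::finite \<Rightarrow> (real^'d) set) \<Rightarrow> (real^'n^'n \<Rightarrow> real^'n^'n) \<Rightarrow> real set \<Rightarrow>
     (real \<Rightarrow> real^'n^'n) \<Rightarrow> (real \<Rightarrow> real^'n^'n) \<Rightarrow> bool" where
  "advected C flat T A \<Gamma> \<longleftrightarrow>
     \<Gamma> differentiable_on T \<and> (\<forall>t\<in>T. \<Gamma> t \<in> velocities C) \<and>
     (\<forall>t\<in>T. \<forall>X\<in>velocities C.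
        pairing C (flat X) (vector_derivative \<Gamma> (at t within T) + commutator (A t) (\<Gamma> t)) = 0)"

definition euler_lagrange ::
    "('n::finite \<Rightarrow> (real^'d) set) \<Rightarrow> (real^'n^'n \<Rightarrow> real^'n^'n) \<Rightarrow> real set \<Rightarrow>
     (real \<Rightarrow> real^'n^'n) \<Rightarrow> bool" where
  "euler_lagrange C flat T A \<longleftrightarrow>
     (\<forall>t\<in>T. \<exists>p :: real^'n. \<forall>i. \<forall>j\<in>neighbours C i.
        (flat (vector_derivative A (at t within T)) + lie1 (A t) (flat (A t)) + d0 p) $ i $ j = 0)"

section \<open>Existence of flat operators\<close>

lemma orient3_skew: "orient3 \<sigma> u v w = - orient3 \<sigma> u w v"
  by (simp add: orient3_def cross_skew[of "(\<chi> c. v $ \<sigma> c)"])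

lemma orient3_rel:
  fixes \<sigma> \<sigma>' :: "3 \<Rightarrow> 'd::finite"
  assumes "bij \<sigma>" "bij \<sigma>'"
  obtains e :: real where "e = 1 \<or> e = -1" "\<And>u v w. orient3 \<sigma>' u v w = e * orient3 \<sigma> u v w"
proof -
  define p where "p = inv \<sigma> \<circ> \<sigma>'"
  have p: "p permutes UNIV"
    using assms unfolding p_def by (intro bij_imp_permutes) (auto intro: bij_comp bij_imp_bij_inv)
  have \<sigma>': "\<sigma>' c = \<sigma> (p c)" for c
    using assms by (simp add: p_def bij_is_surj surj_f_inv_f)
  have d: "orient3 \<tau> u v w = det (\<chi> r c. if r = 1 then u $ \<tau> c else if r = 2 then v $ \<tau> c else w $ \<tau> c :: real^3^3)"
    for \<tau> :: "3 \<Rightarrow> 'd::finite" and u v w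
    unfolding orient3_def cross3_def by (simp add: inner_vec_def sum_3 vector_3 det_3 algebra_simps)
  have *: "orient3 \<sigma>' u v w = of_int (sign p) * orient3 \<sigma> u v w" for u v w
    unfolding d using det_permute_columns[OF p, of "\<chi> r c. if r = 1 then u $ \<sigma> c else if r = 2 then v $ \<sigma> c else w $ \<sigma> c"]
    by (simp only: vec_lambda_beta \<sigma>')
  show thesis
    by (rule that[of "of_int (sign p)"]) (use * in \<open>auto simp: sign_def\<close>)
qed

lemma orient_invariant:
  assumes "e = 1 \<or> e = (-1::real)"
    and "\<And>i j. step_sign \<sigma>' C a' b' i j = e * step_sign \<sigma> C a b i j"
    and "\<And>i j k. triple_sign \<sigma>' C a' b' i j k = e * triple_sign \<sigma> C a b i j k"
    and "voronoi_face C a' b' = voronoi_face C a b" and "closed_segment a' b' = closed_segment a b"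
  shows "K_coeff \<sigma>' C a' b' i j k * omega_DEC \<sigma>' C A a' b' = K_coeff \<sigma> C a b i j k * omega_DEC \<sigma> C A a b"
proof -
  have "K_coeff \<sigma>' C a' b' i j k = e * K_coeff \<sigma> C a b i j k"
    unfolding K_coeff_def assms by simp
  moreover have "omega_DEC \<sigma>' C A a' b' = e * omega_DEC \<sigma> C A a b"
    unfolding omega_DEC_def assms by (simp add: sum_distrib_left mult_ac case_prod_unfold)
  ultimately show ?thesis using assms(1) by auto
qed

lemma inv_sigma:
  assumes "bij (\<sigma> :: 3 \<Rightarrow> 'd::finite)" "bij \<sigma>'"
  shows "K_coeff \<sigma>' C a b i j k * omega_DEC \<sigma>' C A a b = K_coeff \<sigma> C a b i j k * omega_DEC \<sigma> C A a b"
proof -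
  obtain e where e: "e = 1 \<or> e = (-1::real)" "\<And>u v w. orient3 \<sigma>' u v w = e * orient3 \<sigma> u v w"
    using orient3_rel[OF assms] by metis
  show ?thesis
    by (rule orient_invariant[OF e(1)]) (use e(1) in \<open>auto simp: step_sign_def triple_sign_def e(2) sgn_mult\<close>)
qed

lemma orient3_shift1: "orient3 \<sigma> (a - b) (c - b) w = - orient3 \<sigma> (b - a) (c - a) w"
  unfolding orient3_def cross3_def by (simp add: inner_vec_def sum_3 vector_3 algebra_simps)
lemma orient3_shift2: "orient3 \<sigma> (a - b) (c - b) (d - b) = - orient3 \<sigma> (b - a) (c - a) (d - a)"
  unfolding orient3_def cross3_def by (simp add: inner_vec_def sum_3 vector_3 algebra_simps)

lemma inv_edge:
  "K_coeff \<sigma> C b a i j k * omega_DEC \<sigma> C A b a = K_coeff \<sigma> C a b i j k * omega_DEC \<sigma> C A a b"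
proof (rule orient_invariant[of "-1"])
  show "step_sign \<sigma> C b a i j = - 1 * step_sign \<sigma> C a b i j" for i j
    unfolding step_sign_def orient3_shift1[of _ a b] by (simp add: sgn_minus)
  show "triple_sign \<sigma> C b a i j k = - 1 * triple_sign \<sigma> C a b i j k" for i j k
    unfolding triple_sign_def orient3_shift2[of _ a b] by (simp add: sgn_minus)
qed (auto simp: voronoi_face_def closed_segment_commute)

lemma inv_all:
  assumes "bij (\<sigma> :: 3 \<Rightarrow> 'd::finite)" "bij \<sigma>'" "closed_segment a b = closed_segment a' b'"
  shows "K_coeff \<sigma>' C a' b' i j k * omega_DEC \<sigma>' C A a' b' = K_coeff \<sigma> C a b i j k * omega_DEC \<sigma> C A a b"
  using assms(3) inv_sigma[OF assms(1,2), of C a b] inv_sigma[OF assms(1,2), of C b a] inv_edge[of \<sigma> C a b]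
  by (auto simp: closed_segment_eq doubleton_eq_iff)

lemma nb_sym: "i \<in> neighbours C j \<longleftrightarrow> j \<in> neighbours C i"
  by (auto simp: neighbours_def Int_commute)

lemma nb_irrefl: "\<not> i \<in> neighbours C i"
  by (auto simp: neighbours_def facet_of_def)

lemma Omega_antisym:
  assumes "A \<in> velocities C"
  shows "cell_volume C i * A $ i $ j = - (cell_volume C j * A $ j $ i)"
proof -
  have "(transpose A ** Omega C + Omega C ** A) $ i $ j = 0" using assms by (simp add: velocities_def)
  then show ?thesis
    by (simp add: matrix_matrix_mult_def transpose_def Omega_def if_distrib if_distribR sum.delta sum.delta' mult.commute
       cong: if_cong)
qed

lemma adj_antisym:
  assumes "A \<in> velocities C" shows "adjacent_flat C A i j = - adjacent_flat C A j i"
proof -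
  have alt: "adjacent_flat C A i j = 2 * (cell_volume C i * A $ i $ j) * dual_length C i j / face_area C i j" for i j
    by (simp add: adjacent_flat_def)
  have "dual_length C j i = dual_length C i j" "face_area C j i = face_area C i j"
    by (simp_all add: dual_length_def dist_commute face_area_def Int_commute)
  then show ?thesis unfolding alt Omega_antisym[OF assms, of i j] by simp
qed

lemma adj_lin: "adjacent_flat C (A + B) i j = adjacent_flat C A i j + adjacent_flat C B i j"
  "adjacent_flat C (c *\<^sub>R A) i j = c * adjacent_flat C A i j"
  by (simp_all add: adjacent_flat_def algebra_simps add_divide_distrib)

lemma omega_lin: "omega_DEC \<sigma> C (A + B) a b = omega_DEC \<sigma> C A a b + omega_DEC \<sigma> C B a b"
  "omega_DEC \<sigma> C (c *\<^sub>R A) a b = c * omega_DEC \<sigma> C A a b"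
  by (simp_all add: omega_DEC_def adj_lin case_prod_unfold algebra_simps sum.distrib sum_distrib_left)

lemma K_skew: "K_coeff \<sigma> C a b i j k = - K_coeff \<sigma> C a b i k j"
  by (simp add: K_coeff_def triple_sign_def orient3_skew[of _ _ "barycenter (C i \<inter> C k) - a"] sgn_minus)

lemma lebesgue_cbox: "measure lebesgue (cbox a b) = measure lborel (cbox a b)"
  by simp

lemma grid_facts:
  fixes C :: "'n::finite \<Rightarrow> (real^'d) set"
  assumes "cartesian_grid h C" shows "cell_volume C i = h ^ CARD('d)" "h > 0"
proof -
  from assms show h: "h > 0" by (simp add: cartesian_grid_def)
  from assms obtain p :: "real^'d" and z :: "int^'d" where
    Ci: "C i = cbox (\<chi> k. p $ k + h * of_int (z $ k)) (\<chi> k. p $ k + h * (of_int (z $ k) + 1))" (is "_ = cbox ?a ?b")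
    unfolding cartesian_grid_def by blast
  have "cbox ?a ?b \<noteq> {}"
    using h by (simp add: interval_ne_empty_cart)
  then have "measure lborel (cbox ?a ?b) = (\<Prod>k\<in>UNIV. ?b $ k - ?a $ k)"
    by (rule content_cbox_cart)
  also have "\<dots> = (\<Prod>k\<in>(UNIV :: 'd set). h)"
    by (rule prod.cong) (simp_all add: algebra_simps)
  finally show "cell_volume C i = h ^ CARD('d)"
    unfolding cell_volume_def Ci lebesgue_cbox by simp
qed

text \<open>The conditions in \<open>flat_operator\<close> are satisfiable for every mesh.\<close>

lemma flat_operator_exists:
  fixes C :: "'n::finite \<Rightarrow> (real^'d) set"
  shows "\<exists>flat. flat_operator C flat"
proof -
  define N where "N = neighbours C"
  define flatof where "flatof g A = (\<chi> i j. if j \<in> N i then adjacent_flat C A i j else g A i j)"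
    for g :: "real^'n^'n \<Rightarrow> 'n \<Rightarrow> 'n \<Rightarrow> real" and A :: "real^'n^'n"
  have gen: "flat_operator C (flatof g)"
    if lin: "\<And>A B i j. g (A + B) i j = g A i j + g B i j" "\<And>A c i j. g (c *\<^sub>R A) i j = c * g A i j" and
      antis: "\<And>A i j. A \<in> velocities C \<Longrightarrow> i \<notin> N j \<Longrightarrow> g A i j = - g A j i" and
      clauses: "CARD('d) = 3 \<and> simplicial_mesh C \<longrightarrow> flat_simplicial3 C (flatof g)"
      "\<forall>h. CARD('d) = 2 \<and> cartesian_grid h C \<longrightarrow> flat_cartesian2 h C (flatof g)" for g
  proof -
    have "transpose (flatof g A) = - flatof g A" if A: "A \<in> velocities C" for A
    proof -
      have "flatof g A $ j $ i = - flatof g A $ i $ j" for i j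
        using antis[OF A, of j i] adj_antisym[OF A, of j i] nb_sym[of i C j]
        by (auto simp: flatof_def N_def)
      then show ?thesis unfolding vec_eq_iff transpose_def by (metis vec_lambda_beta uminus_vec_def vector_uminus_component)
    qed
    moreover have "flatof g (A + B) = flatof g A + flatof g B" "flatof g (c *\<^sub>R A) = c *\<^sub>R flatof g A" for A B c
      by (simp_all add: flatof_def vec_eq_iff adj_lin lin)
    moreover have "flatof g A $ i $ j = adjacent_flat C A i j" if "j \<in> neighbours C i" for A i j
      using that by (simp add: flatof_def N_def)
    ultimately show ?thesis
      unfolding flat_operator_def using clauses by (intro conjI ballI allI) auto
  qed
  consider (3) "CARD('d) = 3" | (2) h where "CARD('d) = 2" "cartesian_grid h C"
    | (0) "CARD('d) \<noteq> 3" "\<forall>h. \<not> (CARD('d) = 2 \<and> cartesian_grid h C)" by blast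
  then show ?thesis
  proof cases
    case 0
    then show ?thesis using gen[of "\<lambda>A i j. 0"] by auto
  next
    case 2
    have uniq: "h' = h" if "cartesian_grid h' C" for h'
    proof -
      have "h' ^ 2 = h ^ 2" using grid_facts(1)[OF that] grid_facts(1)[OF 2(2)] 2(1) by auto
      then show ?thesis using grid_facts(2)[OF that] grid_facts(2)[OF 2(2)] by (simp add: power2_eq_iff)
    qed
    define g where "g A i j = h\<^sup>2 * (\<Sum>k \<in> N i \<inter> N j. A $ i $ k + A $ k $ j)" for A :: "real^'n^'n" and i j
    have as: "A $ i $ j = - A $ j $ i" if "A \<in> velocities C" for A i j
    proof -
      have "h ^ CARD('d) * A $ i $ j = h ^ CARD('d) * - A $ j $ i"
        using Omega_antisym[OF that, of i j] unfolding grid_facts(1)[OF 2(2)] by simp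
      moreover have "h ^ CARD('d) \<noteq> 0" using grid_facts(2)[OF 2(2)] by simp
      ultimately show ?thesis by (metis mult_left_cancel)
    qed
    have "flat_operator C (flatof g)"
    proof (rule gen)
      fix A i j assume A: "A \<in> velocities C"
      have "A $ i $ k + A $ k $ j = - (A $ j $ k + A $ k $ i)" for k
        using as[OF A, of i k] as[OF A, of k j] by simp
      then show "g A i j = - g A j i"
        by (simp only: g_def Int_commute[of "N j"] sum_negf mult_minus_right)
    next
      show "\<forall>h. CARD('d) = 2 \<and> cartesian_grid h C \<longrightarrow> flat_cartesian2 h C (flatof g)"
        using uniq nb_sym[of _ C] by (auto simp: flat_cartesian2_def flatof_def g_def N_def)
    qed (use 2 in \<open>auto simp: g_def algebra_simps sum.distrib sum_distrib_left\<close>)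
    then show ?thesis by blast
  next
    case 3
    then obtain \<sigma>0 :: "3 \<Rightarrow> 'd::finite" where \<sigma>0: "bij \<sigma>0"
      using finite_same_card_bij[of "UNIV :: 3 set" "UNIV :: 'd set"] by auto
    define m where "m j k = (SOME i. i \<in> N j \<inter> N k)" for j k
    define E where "E j k = (SOME (a, b). closed_segment a b = C (m j k) \<inter> (C j \<inter> C k))" for j k
    define g where "g A j k = (if j = k \<or> N j \<inter> N k = {} then 0 else
       K_coeff \<sigma>0 C (fst (E j k)) (snd (E j k)) (m j k) j k * omega_DEC \<sigma>0 C A (fst (E j k)) (snd (E j k))
       - adjacent_flat C A (m j k) j - adjacent_flat C A k (m j k))" for A j k
    have m_sym: "m j k = m k j" for j k by (simp add: m_def Int_commute)
    have E_sym: "E j k = E k j" for j k by (simp add: E_def m_sym[of j k] Int_commute[of "C j"])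
    have E: "closed_segment (fst (E j k)) (snd (E j k)) = C (m j k) \<inter> C j \<inter> C k"
      if "closed_segment a b = C (m j k) \<inter> C j \<inter> C k" for a b j k
      using someI[of "\<lambda>(a, b). closed_segment a b = C (m j k) \<inter> (C j \<inter> C k)" "(a, b)"] that
      by (auto simp: E_def Int_assoc case_prod_unfold)
    have m: "m j k \<in> N j \<inter> N k" if "N j \<inter> N k \<noteq> {}" for j k
      unfolding m_def using that by (metis some_in_eq)
    have "flat_operator C (flatof g)"
    proof (rule gen)
      fix A i j assume A: "A \<in> velocities C"
      show "g A i j = - g A j i"
        unfolding g_def m_sym[of j i] E_sym[of j i] Int_commute[of "N j"]
        using K_skew[of \<sigma>0 C _ _ _ i j] adj_antisym[OF A, of i "m i j"] adj_antisym[OF A, of j "m i j"]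
        by auto
    next
      show "CARD('d) = 3 \<and> simplicial_mesh C \<longrightarrow> flat_simplicial3 C (flatof g)"
        unfolding flat_simplicial3_def
      proof (intro impI allI)
        fix j k assume jk: "j \<noteq> k \<and> k \<notin> neighbours C j"
        show "if neighbours C j \<inter> neighbours C k = {}
        then \<forall>A\<in>velocities C. flatof g A $ j $ k = 0
        else \<exists>i \<in> neighbours C j \<inter> neighbours C k.
          \<forall>(\<sigma> :: 3 \<Rightarrow> 'd::finite) a b. bij \<sigma> \<and> closed_segment a b = C i \<inter> C j \<inter> C k \<longrightarrow>
            (\<forall>A\<in>velocities C. flatof g A $ i $ j + flatof g A $ j $ k + flatof g A $ k $ i
               = K_coeff \<sigma> C a b i j k * omega_DEC \<sigma> C A a b)"
        proof (cases "N j \<inter> N k = {}")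
          case True
          then show ?thesis using jk by (simp add: flatof_def g_def N_def)
        next
          case False
          note mm = m[OF False]
          have "flatof g A $ m j k $ j + flatof g A $ j $ k + flatof g A $ k $ m j k
               = K_coeff \<sigma> C a b (m j k) j k * omega_DEC \<sigma> C A a b"
            if "bij \<sigma>" "closed_segment a b = C (m j k) \<inter> C j \<inter> C k" for \<sigma> :: "3 \<Rightarrow> 'd::finite" and a b A
          proof -
            have "j \<in> N (m j k)" "m j k \<in> N k" "k \<notin> N j" using mm jk nb_sym[of _ C] by (auto simp: N_def)
            moreover have "closed_segment (fst (E j k)) (snd (E j k)) = closed_segment a b"
              using E[OF that(2)] that(2) by simp
            from inv_all[OF \<sigma>0 that(1) this, of C "m j k" j k A] 
            have "K_coeff \<sigma> C a b (m j k) j k * omega_DEC \<sigma> C A a b =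
              K_coeff \<sigma>0 C (fst (E j k)) (snd (E j k)) (m j k) j k * omega_DEC \<sigma>0 C A (fst (E j k)) (snd (E j k))" .
            ultimately show ?thesis using jk False by (simp add: flatof_def g_def)
          qed
          then show ?thesis using False mm unfolding N_def
            by (simp only: if_False) (intro bexI[of _ "m j k"], blast+)
        qed
      qed
    qed (use 3 in \<open>auto simp: g_def adj_lin omega_lin algebra_simps\<close>)
    then show ?thesis by blast
  qed
qed

end

theory Submission
  imports Defs
begin

text \<open>
  The pairing with a curve in \<open>velocities C\<close> only sees entries of adjacent cells and annihilates
  exact forms, and the Lie derivative is adjoint to the commutator:
  \<open>\<langle>\<langle>L\<^sub>A F, \<Gamma>\<rangle>\<rangle> = - \<langle>\<langle>F, [A, \<Gamma>]\<rangle>\<rangle>\<close>. Differentiating the circulation by the product rule, the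
  Euler--Lagrange equation rewrites the term with the derivative of \<open>A\<close>, and the advection equation,
  tested with \<open>X = A t\<close>, the term with the derivative of \<open>\<Gamma>\<close>; the two cancel.
\<close>

lemma pairing_sum: "pairing C F X = (\<Sum>i\<in>UNIV. \<Sum>j\<in>UNIV. cell_volume C i * X $ i $ j * F $ i $ j)"
proof -
  have *: "(Omega C ** X) $ i $ j = cell_volume C i * X $ i $ j" for i j
    by (simp add: matrix_matrix_mult_def Omega_def if_distribR if_distrib[of "\<lambda>x. x * _"] sum.delta cong: if_cong)
  show ?thesis
    by (simp add: pairing_def trace_def matrix_matrix_mult_def[of "Omega C ** X"] transpose_def *)
qed

lemma bilinear_pairing: "bounded_bilinear (pairing C)"
  unfolding bilinear_conv_bounded_bilinear[symmetric] bilinear_def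
  by (auto intro!: linearI simp: pairing_sum algebra_simps sum.distrib sum_distrib_left)

text \<open>All three conditions are homogeneous linear equations in the entries. This is what
  allows linear extension of the flat operator and keeps the derivative of a curve of velocities
  among the velocities.\<close>

lemma subspace_velocities: "subspace (velocities C)"
proof -
  define q where "q A i j = A $ j $ i * cell_volume C j + cell_volume C i * A $ i $ j" for A :: "real^'a^'a" and i j
  have "(transpose A ** Omega C + Omega C ** A) $ i $ j = q A i j" for A i j
    by (simp add: q_def matrix_matrix_mult_def transpose_def Omega_def if_distribR
        if_distrib[of "\<lambda>x. x * _"] if_distrib[of "\<lambda>x. _ * x"] sum.delta sum.delta' cong: if_cong)
  then have eq: "velocities C = {A. (\<forall>i j. q A i j = 0) \<and>
      (\<forall>i. (\<Sum>j\<in>UNIV. A $ i $ j) = 0) \<and> (\<forall>i j. A $ i $ j \<noteq> 0 \<longrightarrow> j \<in> neighbours C i)}"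
    by (simp add: velocities_def vec_eq_iff)
  have "q 0 i j = 0" "q (A + B) i j = q A i j + q B i j" "q (c *\<^sub>R A) i j = c * q A i j" for A B c i j
    by (simp_all add: q_def algebra_simps)
  then show ?thesis
    unfolding eq subspace_def
    by (auto simp: sum.distrib sum_distrib_left[symmetric]) (metis add_0)
qed

lemma velocities_row_sum: "A \<in> velocities C \<Longrightarrow> (\<Sum>j\<in>UNIV. A $ i $ j) = 0"
  by (simp add: velocities_def)

lemma velocities_sparse: "A \<in> velocities C \<Longrightarrow> j \<notin> neighbours C i \<Longrightarrow> A $ i $ j = 0"
  by (auto simp: velocities_def)

text \<open>By \<Omega>-antisymmetry, the weighted column \<open>j\<close> is minus
  \<open>cell_volume C j\<close> times row \<open>j\<close>, and rows sum to zero.\<close>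

lemma velocities_weighted_col_sum:
  assumes "A \<in> velocities C"
  shows "(\<Sum>i\<in>UNIV. cell_volume C i * A $ i $ j) = 0"
proof -
  have "(\<Sum>i\<in>UNIV. cell_volume C i * A $ i $ j) = (\<Sum>i\<in>UNIV. - cell_volume C j * A $ j $ i)"
    by (intro sum.cong refl) (simp add: Omega_antisym[OF assms, of _ j])
  then show ?thesis
    by (simp only: sum_distrib_left[symmetric] velocities_row_sum[OF assms] mult_zero_right)
qed

text \<open>Discrete form of "an exact form integrates to zero over a closed curve": the
  \<open>f $ j\<close> part dies by weighted column sums, the \<open>f $ i\<close> part by row
  sums.\<close>

lemma pairing_d0:
  assumes "X \<in> velocities C"
  shows "pairing C (d0 f) X = 0"
proof -
  have "pairing C (d0 f) X = (\<Sum>i\<in>UNIV. \<Sum>j\<in>UNIV. f $ j * (cell_volume C i * X $ i $ j))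
      - (\<Sum>i\<in>UNIV. \<Sum>j\<in>UNIV. (f $ i * cell_volume C i) * X $ i $ j)"
    by (simp add: pairing_sum d0_def sum_subtractf algebra_simps)
  also have "(\<Sum>i\<in>UNIV. \<Sum>j\<in>UNIV. f $ j * (cell_volume C i * X $ i $ j))
      = (\<Sum>j\<in>UNIV. \<Sum>i\<in>UNIV. f $ j * (cell_volume C i * X $ i $ j))"
    by (rule sum.swap)
  finally show ?thesis
    by (simp only: sum_distrib_left[symmetric] velocities_row_sum[OF assms]
        velocities_weighted_col_sum[OF assms]) simp
qed

text \<open>The weights \<open>g\<close> are antisymmetric, so both summands of
  \<open>contract2\<close> contribute the same, whence the factor 2. Of the three terms of
  \<open>d1 F $ i $ k $ j\<close>, only \<open>F $ k $ j\<close> depends on both summation indices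
  \<open>j\<close> and \<open>k\<close>; the others leave a free row sum of \<open>X\<close> or
  \<open>A\<close>.\<close>

lemma pairing_contract2_d1:
  assumes "A \<in> velocities C" "X \<in> velocities C" "transpose F = - F"
  shows "pairing C (contract2 A (d1 F)) X
    = 2 * (\<Sum>i\<in>UNIV. \<Sum>j\<in>UNIV. \<Sum>k\<in>UNIV. cell_volume C i * X $ i $ j * A $ i $ k * F $ k $ j)"
proof -
  define g where "g i j = cell_volume C i * X $ i $ j" for i j
  define S where "S = (\<Sum>i\<in>UNIV. \<Sum>j\<in>UNIV. \<Sum>k\<in>UNIV. g i j * (d1 F $ i $ k $ j * A $ i $ k))"
  have anti: "g i j = - g j i" for i j
    unfolding g_def by (rule Omega_antisym[OF assms(2)])
  have "pairing C (contract2 A (d1 F)) X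
      = S - (\<Sum>i\<in>UNIV. \<Sum>j\<in>UNIV. \<Sum>k\<in>UNIV. g i j * (d1 F $ j $ k $ i * A $ j $ k))"
    by (simp only: pairing_sum contract2_def vec_lambda_beta S_def g_def sum_subtractf sum_distrib_left right_diff_distrib)
  \<comment> \<open>Exchanging the names \<open>i\<close> and \<open>j\<close> matches the term with
    \<open>S\<close> up to the sign of \<open>g\<close>.\<close>
  also have "(\<Sum>i\<in>UNIV. \<Sum>j\<in>UNIV. \<Sum>k\<in>UNIV. g i j * (d1 F $ j $ k $ i * A $ j $ k))
      = (\<Sum>i\<in>UNIV. \<Sum>j\<in>UNIV. \<Sum>k\<in>UNIV. g j i * (d1 F $ i $ k $ j * A $ i $ k))"
    by (rule sum.swap)
  also have "\<dots> = - S"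
    unfolding S_def sum_negf[symmetric] by (intro sum.cong refl) (subst anti, simp)
  finally have 1: "pairing C (contract2 A (d1 F)) X = 2 * S" by simp
  have "S = (\<Sum>i\<in>UNIV. \<Sum>j\<in>UNIV. \<Sum>k\<in>UNIV. A $ i $ k * F $ i $ k * g i j)
      + (\<Sum>i\<in>UNIV. \<Sum>j\<in>UNIV. \<Sum>k\<in>UNIV. g i j * A $ i $ k * F $ k $ j)
      + (\<Sum>i\<in>UNIV. \<Sum>j\<in>UNIV. \<Sum>k\<in>UNIV. g i j * F $ j $ i * A $ i $ k)"
    unfolding S_def sum.distrib[symmetric]
    by (intro sum.cong refl) (simp add: d1_def algebra_simps)
  also have "(\<Sum>i\<in>UNIV. \<Sum>j\<in>UNIV. \<Sum>k\<in>UNIV. g i j * F $ j $ i * A $ i $ k) = 0"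
    by (simp only: sum_distrib_left[symmetric] velocities_row_sum[OF assms(1)]) simp
  also have "(\<Sum>i\<in>UNIV. \<Sum>j\<in>UNIV. \<Sum>k\<in>UNIV. A $ i $ k * F $ i $ k * g i j)
      = (\<Sum>i\<in>UNIV. \<Sum>k\<in>UNIV. \<Sum>j\<in>UNIV. A $ i $ k * F $ i $ k * g i j)"
    by (intro sum.cong refl sum.swap)
  also have "\<dots> = 0"
    unfolding g_def
    by (simp only: sum_distrib_left[symmetric] velocities_row_sum[OF assms(2)]) simp
  finally show ?thesis
    unfolding 1 by (simp add: g_def)
qed

text \<open>Moving the volume weight by \<Omega>-antisymmetry turns both matrix products into the
  same triple sum. For \<open>A ** X\<close> this costs one sign; for \<open>X ** A\<close> that
  sign is cancelled by the antisymmetry of \<open>F\<close>, so the difference is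
  \<open>- ?R - ?R\<close>.\<close>

lemma pairing_commutator:
  assumes "A \<in> velocities C" "X \<in> velocities C" "transpose F = - F"
  shows "pairing C F (commutator A X)
    = - 2 * (\<Sum>i\<in>UNIV. \<Sum>j\<in>UNIV. \<Sum>k\<in>UNIV. cell_volume C i * X $ i $ j * A $ i $ k * F $ k $ j)"
    (is "_ = - 2 * ?R")
proof -
  have F: "F $ j $ i = - F $ i $ j" for i j
    using arg_cong[OF assms(3), of "\<lambda>M. M $ i $ j"] by (simp add: transpose_def)
  have "pairing C F (commutator A X)
      = (\<Sum>i\<in>UNIV. \<Sum>j\<in>UNIV. \<Sum>k\<in>UNIV. cell_volume C i * A $ i $ k * X $ k $ j * F $ i $ j)
      - (\<Sum>i\<in>UNIV. \<Sum>j\<in>UNIV. \<Sum>k\<in>UNIV. cell_volume C i * X $ i $ k * A $ k $ j * F $ i $ j)"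
    unfolding pairing_sum commutator_def matrix_matrix_mult_def vector_minus_component
      vec_lambda_beta sum_subtractf[symmetric] sum_distrib_left sum_distrib_right
    by (intro sum.cong refl) (simp add: algebra_simps)
  also have "(\<Sum>i\<in>UNIV. \<Sum>j\<in>UNIV. \<Sum>k\<in>UNIV. cell_volume C i * A $ i $ k * X $ k $ j * F $ i $ j)
      = (\<Sum>i\<in>UNIV. \<Sum>j\<in>UNIV. \<Sum>k\<in>UNIV. - (cell_volume C k * X $ k $ j * A $ k $ i * F $ i $ j))"
    by (intro sum.cong refl) (subst Omega_antisym[OF assms(1)], simp add: mult_ac)
  also have "\<dots> = - (\<Sum>j\<in>UNIV. \<Sum>i\<in>UNIV. \<Sum>k\<in>UNIV. cell_volume C k * X $ k $ j * A $ k $ i * F $ i $ j)"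
    unfolding sum_negf by (subst sum.swap) (rule refl)
  also have "\<dots> = - (\<Sum>j\<in>UNIV. \<Sum>k\<in>UNIV. \<Sum>i\<in>UNIV. cell_volume C k * X $ k $ j * A $ k $ i * F $ i $ j)"
    by (intro arg_cong[of _ _ uminus] sum.cong refl sum.swap)
  also have "\<dots> = - ?R"
    by (intro arg_cong[of _ _ uminus] sum.swap)
  also have "(\<Sum>i\<in>UNIV. \<Sum>j\<in>UNIV. \<Sum>k\<in>UNIV. cell_volume C i * X $ i $ k * A $ k $ j * F $ i $ j)
      = (\<Sum>i\<in>UNIV. \<Sum>j\<in>UNIV. \<Sum>k\<in>UNIV. cell_volume C k * X $ k $ i * A $ k $ j * F $ j $ i)"
    by (intro sum.cong refl) (subst Omega_antisym[OF assms(2)], subst F, simp)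
  also have "\<dots> = (\<Sum>i\<in>UNIV. \<Sum>k\<in>UNIV. \<Sum>j\<in>UNIV. cell_volume C k * X $ k $ i * A $ k $ j * F $ j $ i)"
    by (intro sum.cong refl sum.swap)
  also have "\<dots> = ?R"
    by (rule sum.swap)
  finally show ?thesis by simp
qed

text \<open>The exact part of Cartan's formula drops out, and the remaining part and the commutator
  give opposite multiples of one triple sum.\<close>

lemma pairing_lie1:
  assumes "A \<in> velocities C" "X \<in> velocities C" "transpose F = - F"
  shows "pairing C (lie1 A F) X = - pairing C F (commutator A X)"
  by (simp add: lie1_def bounded_bilinear.add_left[OF bilinear_pairing] pairing_d0[OF assms(2)]
      pairing_contract2_d1[OF assms] pairing_commutator[OF assms])

text \<open>Lets an equation known only at adjacent cells, such as the Euler--Lagrange equation, be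
  paired with a curve.\<close>

lemma pairing_sparse_cong:
  assumes "X \<in> velocities C" "\<And>i j. j \<in> neighbours C i \<Longrightarrow> F $ i $ j = G $ i $ j"
  shows "pairing C F X = pairing C G X"
  unfolding pairing_sum
  by (intro sum.cong refl) (metis assms(2) mult_zero_left mult_zero_right velocities_sparse[OF assms(1)])

text \<open>The flat operator is linear only on velocities; a globally linear extension is bounded
  and can be differentiated through.\<close>

lemma linear_on_subspace_extend:
  fixes f :: "'a::euclidean_space \<Rightarrow> 'b::real_vector"
  assumes "subspace S" "\<And>x y. x \<in> S \<Longrightarrow> y \<in> S \<Longrightarrow> f (x + y) = f x + f y"
    "\<And>x c. x \<in> S \<Longrightarrow> f (c *\<^sub>R x) = c *\<^sub>R f x"
  obtains g where "linear g" "\<And>x. x \<in> S \<Longrightarrow> g x = f x"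
proof -
  obtain B where B: "B \<subseteq> S" "independent B" "S \<subseteq> span B"
    using basis_exists[of S] by metis
  obtain g where g: "linear g" "\<forall>x\<in>B. g x = f x"
    using linear_independent_extend[OF B(2)] by blast
  have "f 0 = 0"
    using assms(3)[of 0 0] subspace_0[OF assms(1)] by simp
  then have "subspace {x \<in> S. g x = f x}"
    using assms(1) g(1)
    by (intro subspaceI)
      (auto simp: assms(2,3) linear_add linear_scale linear_0 subspace_0 subspace_add subspace_scale)
  then have "span B \<subseteq> {x \<in> S. g x = f x}"
    using B(1) g(2) by (intro span_minimal) auto
  with B(3) show thesis by (intro that[OF g(1)]) auto
qed

text \<open>Every \<open>y\<close> orthogonal to \<open>S\<close> has
  \<open>y \<bullet> f s = 0\<close> on \<open>T\<close>, so uniqueness of derivatives gives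
  \<open>y \<bullet> D = 0\<close>, and \<open>S\<close> is its own double orthogonal
  complement.\<close>

lemma has_vector_derivative_in_subspace:
  fixes f :: "real \<Rightarrow> 'a::euclidean_space"
  assumes "subspace S" "\<And>s. s \<in> T \<Longrightarrow> f s \<in> S"
    "(f has_vector_derivative D) (at t within T)" "t \<in> T" "at t within T \<noteq> bot"
  shows "D \<in> S"
proof -
  have "y \<bullet> D = 0" if "y \<in> S\<^sup>\<bottom>" for y
  proof -
    have "((\<lambda>s. y \<bullet> f s) has_vector_derivative y \<bullet> D) (at t within T)"
      using bounded_linear.has_vector_derivative[OF bounded_linear_inner_right assms(3)] .
    moreover have "y \<bullet> f s = 0" if "s \<in> T" for s
      using \<open>y \<in> S\<^sup>\<bottom>\<close> assms(2)[OF that] by (auto simp: orthogonal_comp_def orthogonal_def inner_commute)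
    then have "((\<lambda>s. y \<bullet> f s) has_vector_derivative 0) (at t within T)"
      by (intro has_vector_derivative_transform[OF assms(4) _ has_vector_derivative_const[of 0]]) auto
    ultimately show ?thesis
      using vector_derivative_unique_within[OF assms(5)] by blast
  qed
  then have "D \<in> S\<^sup>\<bottom>\<^sup>\<bottom>"
    by (auto simp: orthogonal_comp_def orthogonal_def)
  then show ?thesis
    by (simp add: orthogonal_comp_self[OF assms(1)])
qed

theorem theorem2:
  fixes C :: "'n::finite \<Rightarrow> (real^'d) set"
    and flat :: "real^'n^'n \<Rightarrow> real^'n^'n"
    and T :: "real set"
    and A \<Gamma> :: "real \<Rightarrow> real^'n^'n"
    and \<Gamma>0 :: "real^'n^'n"
  assumes "mesh C"
    and "flat_operator C flat"
    and "is_interval T" and "0 \<in> T"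
    and "smooth_curve T A" and "\<forall>t\<in>T. A t \<in> velocities C"
    and "euler_lagrange C flat T A"
    and "\<Gamma>0 \<in> velocities C"
    and "advected C flat T A \<Gamma>" and "\<Gamma> 0 = \<Gamma>0"
  shows "\<forall>t\<in>T. circulation C flat (\<Gamma> t) (A t) = circulation C flat \<Gamma>0 (A 0)"
\<comment> \<open>At an isolated point derivatives are not unique, so the one-point interval is
  treated apart.\<close>
proof (cases "T = {0}")
  case True
  then show ?thesis using assms(10) by simp
next
  case False
  note add_left = bounded_bilinear.add_left[OF bilinear_pairing]
  \<comment> \<open>A connected set with more than one point has no isolated points.\<close>
  have nontriv: "at t within T \<noteq> bot" if "t \<in> T" for t
  proof -
    have "T \<noteq> {x}" for x using assms(4) False by auto
    then show ?thesis
      using connected_imp_perfect[of T t] that assms(3)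
      by (simp add: is_interval_connected_1 trivial_limit_within)
  qed
  obtain flat' where flat': "linear flat'" "\<And>X. X \<in> velocities C \<Longrightarrow> flat' X = flat X"
    using linear_on_subspace_extend[OF subspace_velocities, of C flat] assms(2)
    unfolding flat_operator_def by metis
  have "((\<lambda>s. pairing C (flat' (A s)) (\<Gamma> s)) has_vector_derivative 0) (at t within T)" if t: "t \<in> T" for t
  proof -
    define A' where "A' = vector_derivative A (at t within T)"
    define \<Gamma>' where "\<Gamma>' = vector_derivative \<Gamma> (at t within T)"
    have At: "A t \<in> velocities C" and \<Gamma>t: "\<Gamma> t \<in> velocities C"
      using assms(6,9) t by (auto simp: advected_def)
    have dA: "(A has_vector_derivative A') (at t within T)"
      using assms(5) t unfolding smooth_curve_def A'_def
      by (metis differentiableI_vector vector_derivative_works)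
    have d\<Gamma>: "(\<Gamma> has_vector_derivative \<Gamma>') (at t within T)"
      using assms(9) t unfolding advected_def differentiable_on_def \<Gamma>'_def
      by (metis vector_derivative_works)
    \<comment> \<open>Needed to replace \<open>flat' A'\<close>, produced by the chain rule, by the
      \<open>flat A'\<close> of the Euler--Lagrange equation.\<close>
    have A': "A' \<in> velocities C"
      using has_vector_derivative_in_subspace[OF subspace_velocities _ dA t nontriv[OF t]] assms(6) by blast
    have skew: "transpose (flat (A t)) = - flat (A t)"
      using assms(2) At by (simp add: flat_operator_def)
    obtain p where p: "\<And>i j. j \<in> neighbours C i \<Longrightarrow> (flat A' + lie1 (A t) (flat (A t)) + d0 p) $ i $ j = 0"
      using assms(7) t unfolding euler_lagrange_def A'_def by blast
    have "pairing C (flat A' + lie1 (A t) (flat (A t)) + d0 p) (\<Gamma> t) = pairing C 0 (\<Gamma> t)"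
      using p by (intro pairing_sparse_cong \<Gamma>t) simp
    then have EL: "pairing C (flat A') (\<Gamma> t) = pairing C (flat (A t)) (commutator (A t) (\<Gamma> t))"
      by (simp add: add_left pairing_d0[OF \<Gamma>t] pairing_lie1[OF At \<Gamma>t skew]
          bounded_bilinear.zero_left[OF bilinear_pairing])
    have adv: "pairing C (flat (A t)) (\<Gamma>' + commutator (A t) (\<Gamma> t)) = 0"
      using assms(9) t At unfolding advected_def \<Gamma>'_def by blast
    have "((\<lambda>s. pairing C (flat' (A s)) (\<Gamma> s)) has_vector_derivative
        pairing C (flat' (A t)) \<Gamma>' + pairing C (flat' A') (\<Gamma> t)) (at t within T)"
      using bounded_linear.has_vector_derivative[OF linear_conv_bounded_linear[THEN iffD1, OF flat'(1)] dA] d\<Gamma>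
      by (rule bounded_bilinear.has_vector_derivative[OF bilinear_pairing])
    moreover have "pairing C (flat' (A t)) \<Gamma>' + pairing C (flat' A') (\<Gamma> t) = 0"
      using adv EL
      by (simp add: flat'(2)[OF At] flat'(2)[OF A'] bounded_bilinear.add_right[OF bilinear_pairing])
    ultimately show ?thesis by simp
  qed
  \<comment> \<open>A vanishing derivative on a convex set forces a constant; along \<open>A\<close>
    the extension agrees with \<open>flat\<close>.\<close>
  then obtain c where "\<And>t. t \<in> T \<Longrightarrow> pairing C (flat' (A t)) (\<Gamma> t) = c"
    using has_vector_derivative_zero_constant[OF is_interval_convex[OF assms(3)]] by blast
  then have "\<And>t. t \<in> T \<Longrightarrow> circulation C flat (\<Gamma> t) (A t) = c"
    using assms(6) flat'(2) by (simp add: circulation_def)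
  then show ?thesis using assms(4,10) by auto
qed

end
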